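(* Fix a normal agent $i$ (at a fixed time step) with neighbor set $\mathcal{N}_i^+=\mathcal{N}_i\cup\mathcal{M}_i$ (disjoint union of normal neighbors $\mathcal{N}_i\ni i$ and Byzantine neighbors $\mathcal{M}_i$), let $\kappa_i=|\mathcal{M}_i|$, $d_i=|\mathcal{N}_i^+|$, and let $x_\ell\in\mathbb{R}^n$, $\ell\in\mathcal{N}_i^+$, be the states available to agent $i$ (those for $\ell\in\mathcal{M}_i$ being arbitrary). Suppose $d_i\ge (n+1)\kappa_i+2$. Then, for every integer $\sigma_i\in[n\kappa_i+2,\ d_i-\kappa_i]$, any vector $v_i^\star$ obtained by Algorithm 1 (see context) with parameter $\sigma_i$ is a $(\gamma_i,\alpha_i)$-resilient convex combination, where $$\gamma_i=d_i-\kappa_i-\sigma_i+2,\qquad \alpha_i=\frac{1}{(s_i+1)(n+1)},\qquad s_i=\binom{d_i-1}{\sigma_i-1}.$$ That is, there exist weights $w_{i\ell}^\star\in[0,1]$, $\ell\in\mathcal{N}_i$, with $\sum_{\ell\in\mathcal{N}_i}w_{i\ell}^\star=1$ and $v_i^\star=\sum_{\ell\in\mathcal{N}_i}w_{i\ell}^\star x_\ell$, such that at least $\gamma_i$ of the weights $w^\star_{i\ell}$ satisfy $w_{i\ell}^\star\ge\alpha_i$.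
   Context: Notation. For a finite set of agents $\mathcal{A}$, $x_{\mathcal{A}}=\{x_j : j\in\mathcal{A}\}$, and $\mathcal{H}(x_{\mathcal{A}})$ is the convex hull of these vectors in $\mathbb{R}^n$. Agent $i$ does not know which of its neighbors are Byzantine. Algorithm 1 (for agent $i$; input $\mathcal{N}_i^+$, $x_{\mathcal{N}_i^+}$, $\kappa_i$). Let $d_i=|\mathcal{N}_i^+|$ and choose an integer $\sigma_i\in[n\kappa_i+2,\,d_i-\kappa_i]$. Let $s_i=\binom{d_i-1}{\sigma_i-1}$ and let $\mathcal{S}_{ij}$, $j=1,\dots,s_i$, be all the subsets of $\mathcal{N}_i^+$ with $i\in\mathcal{S}_{ij}$ and $|\mathcal{S}_{ij}|=\sigma_i$. For each $j$ put $\widehat{\mathcal{S}}_{ij}=\mathcal{S}_{ij}\setminus\{i\}$ and: - if $x_i\in\mathcal{H}(x_{\widehat{\mathcal{S}}_{ij}})$, let $\phi_{ij}=x_i$; - otherwise, let $b_i=\binom{\sigma_i-1}{\kappa_i}$, let $\mathcal{B}_{ijk}$, $k=1,\dots,b_i$, be all the subsets of $\mathcal{S}_{ij}$ with $i\in\mathcal{B}_{ijk}$ and $|\mathcal{B}_{ijk}|=\sigma_i-\kappa_i$, and let $\phi_{ij}$ be any point of $\left(\bigcap_{k=1}^{b_i}\mathcal{H}(x_{\mathcal{B}_{ijk}})\right)\cap\mathcal{H}(x_{\widehat{\mathcal{S}}_{ij}})$ (that this set is non-empty is part of the validity of the algorithm). Output $v_i^\star=\dfrac{x_i+\sum_{j=1}^{s_i}\phi_{ij}}{s_i+1}$.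 *)

theory Defs
  imports "HOL-Analysis.Analysis"
begin

definition subsets_through :: "'a \<Rightarrow> 'a set \<Rightarrow> nat \<Rightarrow> 'a set set" where
  "subsets_through i A m = {S. S \<subseteq> A \<and> i \<in> S \<and> card S = m}"

text \<open>
  The points that agent \<open>i\<close> may choose as \<open>\<phi>\<close> for one selected subset \<open>S\<close> of its
  neighborhood. The choice only uses data available to the agent: the states \<open>x\<close> and the
  bound \<open>\<kappa>\<close>, not the set of Byzantine neighbors.
\<close>
definition admissible_points ::
    "'a \<Rightarrow> ('a \<Rightarrow> real ^ 'n) \<Rightarrow> nat \<Rightarrow> 'a set \<Rightarrow> (real ^ 'n) set" where
  "admissible_points i x \<kappa> S =
     (if x i \<in> convex hull (x ` (S - {i})) then {x i}
      else (\<Inter>B \<in> subsets_through i S (card S - \<kappa>). convex hull (x ` B))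
             \<inter> convex hull (x ` (S - {i})))"

text \<open>
  The algorithm is nondeterministic, so it is a relation: \<open>v\<close> is a possible output for the
  neighborhood \<open>Np\<close> (which includes \<open>i\<close>). The chosen points are indexed by the subsets \<open>S\<close>
  themselves rather than by an enumeration of them.
\<close>
definition algorithm_output ::
    "'a \<Rightarrow> 'a set \<Rightarrow> ('a \<Rightarrow> real ^ 'n) \<Rightarrow> nat \<Rightarrow> nat \<Rightarrow> real ^ 'n \<Rightarrow> bool" where
  "algorithm_output i Np x \<kappa> \<sigma> v \<longleftrightarrow>
     (\<exists>\<phi>. (\<forall>S \<in> subsets_through i Np \<sigma>. \<phi> S \<in> admissible_points i x \<kappa> S) \<and>
          v = (1 / (real ((card Np - 1) choose (\<sigma> - 1)) + 1)) *\<^sub>R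
                (x i + (\<Sum>S \<in> subsets_through i Np \<sigma>. \<phi> S)))"

text \<open>Here \<open>N\<close> is the set of normal neighbors only; Byzantine states get no weight.\<close>
definition resilient_convex_combination ::
    "nat \<Rightarrow> real \<Rightarrow> 'a set \<Rightarrow> ('a \<Rightarrow> real ^ 'n) \<Rightarrow> real ^ 'n \<Rightarrow> bool" where
  "resilient_convex_combination \<gamma> \<alpha> N x v \<longleftrightarrow>
     (\<exists>w. (\<forall>l \<in> N. 0 \<le> w l \<and> w l \<le> 1) \<and> (\<Sum>l \<in> N. w l) = 1 \<and>
          v = (\<Sum>l \<in> N. w l *\<^sub>R x l) \<and>
          \<gamma> \<le> card {l \<in> N. \<alpha> \<le> w l})"

end

theory Submission
  imports Defs
begin

text \<open>
  Non-emptiness of the set of admissible points is Helly's theorem: \<open>n\<close> of the sets \<open>\<B>\<close>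
  discard at most \<open>n\<kappa>\<close> agents in total and so share an agent other than \<open>i\<close>. Every \<open>\<phi>\<close> lies in
  the hull of the normal states because some \<open>\<B>\<close> contains only normal agents. For a selected set
  \<open>S\<close> of normal agents, Caratheodory's theorem writes \<open>\<phi>\<close> as a convex combination of at most
  \<open>n + 1\<close> states of \<open>S - {i}\<close>, so some agent of \<open>S - {i}\<close> receives weight at least
  \<open>1 / (n + 1)\<close>. The normal agents other than \<open>i\<close> with small total weight therefore
  contain no set of \<open>\<sigma> - 1\<close> elements.
\<close>

section \<open>Counting the selected subsets\<close>

lemma finite_subsets_through: "finite A \<Longrightarrow> finite (subsets_through i A m)"
  unfolding subsets_through_def by (rule finite_subset[of _ "Pow A"]) auto

text \<open>Removing \<open>i\<close> matches these sets with the subsets of \<open>A - {i}\<close>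
  of size \<open>m - 1\<close>. This identifies the binomial divisor of the algorithm with the
  number of averaged points. For \<open>m = 0\<close> the truncated \<open>m - 1\<close> would give
  1 instead of 0.\<close>

lemma card_subsets_through:
  assumes "finite A" "i \<in> A" "1 \<le> m"
  shows "card (subsets_through i A m) = (card A - 1) choose (m - 1)"
proof -
  have "bij_betw (insert i) {T. T \<subseteq> A - {i} \<and> card T = m - 1} (subsets_through i A m)"
  proof (rule bij_betw_byWitness[where f' = "\<lambda>S. S - {i}"])
    show "insert i ` {T. T \<subseteq> A - {i} \<and> card T = m - 1} \<subseteq> subsets_through i A m"
    proof
      fix S assume "S \<in> insert i ` {T. T \<subseteq> A - {i} \<and> card T = m - 1}"
      then obtain T where T: "S = insert i T" "T \<subseteq> A - {i}" "card T = m - 1" by auto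
      moreover have "finite T" using T assms(1) finite_subset by blast
      moreover have "i \<notin> T" using T by auto
      ultimately show "S \<in> subsets_through i A m"
        using assms by (auto simp: subsets_through_def)
    qed
  qed (auto simp: subsets_through_def)
  then have "card (subsets_through i A m) = card {T. T \<subseteq> A - {i} \<and> card T = m - 1}"
    by (simp add: bij_betw_same_card)
  also have "\<dots> = card (A - {i}) choose (m - 1)"
    using assms by (intro n_subsets) auto
  finally show ?thesis using assms by simp
qed

section \<open>Helly and Caratheodory in the form used below\<close>

text \<open>Helly's theorem concerns families of at least \<open>DIM('a) + 1\<close> sets; a smaller
  family is itself one of the subfamilies assumed to meet. Thus it need not be known how many of the
  hulls are distinct.\<close>

lemma helly_finite:
  fixes \<F> :: "'a::euclidean_space set set"
  assumes "finite \<F>" "\<And>C. C \<in> \<F> \<Longrightarrow> convex C"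
    and int: "\<And>\<T>. \<T> \<subseteq> \<F> \<Longrightarrow> card \<T> \<le> DIM('a) + 1 \<Longrightarrow> \<Inter>\<T> \<noteq> {}"
  shows "\<Inter>\<F> \<noteq> {}"
proof (cases "card \<F> \<le> DIM('a) + 1")
  case True
  then show ?thesis using int by blast
next
  case False
  show ?thesis
  proof (rule Helly)
    show "DIM('a) + 1 \<le> card \<F>" using False by linarith
    show "\<forall>C\<in>\<F>. convex C" using assms(2) by blast
    show "\<Inter>\<T> \<noteq> {}" if "\<T> \<subseteq> \<F>" "card \<T> = DIM('a) + 1" for \<T>
      using that by (intro int) simp_all
  qed
qed

text \<open>Caratheodory leaves at most \<open>DIM('b) + 1\<close> points, and their weights sum to
  1, so one of them reaches the average.\<close>

lemma convex_hull_image_weights: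
  fixes x :: "'a \<Rightarrow> 'b::euclidean_space"
  assumes "p \<in> convex hull (x ` A)" "A \<subseteq> N" "finite N"
  obtains u where "\<And>l. 0 \<le> u l" "sum u N = 1" "p = (\<Sum>l\<in>N. u l *\<^sub>R x l)"
    "\<exists>j\<in>A. 1 / (real DIM('b) + 1) \<le> u j"
proof -
  obtain S where S: "finite S" "S \<subseteq> x ` A" "card S \<le> DIM('b) + 1" "p \<in> convex hull S"
    using assms(1) caratheodory[of "x ` A"] by auto
  \<comment> \<open>Agents may share a state, so each point of \<open>S\<close> gets one
    representative index before its weight is moved to the agents.\<close>
  obtain C where C: "C \<subseteq> A" "inj_on x C" "S = x ` C"
    using S(2) by (auto simp: subset_image_inj)
  have finC: "finite C" using S(1) C by (simp add: finite_image_iff)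
  have CN: "C \<subseteq> N" using C assms by auto
  have cardC: "card C \<le> DIM('b) + 1" using S(3) C by (simp add: card_image)
  obtain c where c: "\<forall>y\<in>S. 0 \<le> c y" "sum c S = 1" "(\<Sum>y\<in>S. c y *\<^sub>R y) = p"
    using S(4) S(1) by (auto simp: convex_hull_finite)
  define u where "u = (\<lambda>l. if l \<in> C then c (x l) else 0)"
  have sumC: "sum u C = 1" "p = (\<Sum>l\<in>C. u l *\<^sub>R x l)"
    using c C by (auto simp: sum.reindex u_def)
  have u0: "\<And>l. 0 \<le> u l" using c C by (auto simp: u_def)
  have "sum u N = sum u C" "(\<Sum>l\<in>N. u l *\<^sub>R x l) = (\<Sum>l\<in>C. u l *\<^sub>R x l)"
    using CN assms(3) by (intro sum.mono_neutral_right; simp add: u_def)+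
  moreover have "\<exists>j\<in>A. 1 / (real DIM('b) + 1) \<le> u j"
  proof (rule ccontr)
    assume "\<not> ?thesis"
    then have "\<And>j. j \<in> C \<Longrightarrow> u j < 1 / (real DIM('b) + 1)" using C by force
    moreover have "C \<noteq> {}" using sumC by auto
    ultimately have "sum u C < (\<Sum>j\<in>C. 1 / (real DIM('b) + 1))"
      using finC by (intro sum_strict_mono) auto
    also have "\<dots> = real (card C) / (real DIM('b) + 1)" by simp
    also have "\<dots> \<le> 1" using cardC by (simp add: divide_le_eq)
    finally show False using sumC by simp
  qed
  ultimately show thesis using that u0 sumC by metis
qed

section \<open>Validity of the algorithm\<close>

text \<open>The hull of \<open>S - {i}\<close> joins the Helly family. A subfamily without it has
  the common point \<open>x i\<close>; a subfamily with it leaves room for at most n of the other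
  hulls, which share the state of an agent other than \<open>i\<close>.\<close>

lemma admissible_points_nonempty:
  fixes x :: "'a \<Rightarrow> real ^ 'n"
  assumes "finite S" "i \<in> S" and card: "CARD('n) * \<kappa> + 2 \<le> card S"
  shows "admissible_points i x \<kappa> S \<noteq> {}"
proof (cases "x i \<in> convex hull (x ` (S - {i}))")
  case True
  then show ?thesis by (simp add: admissible_points_def)
next
  case False
  let ?\<B> = "subsets_through i S (card S - \<kappa>)"
  let ?H = "\<lambda>B. convex hull (x ` B)"
  have fin\<B>: "finite ?\<B>" using assms(1) by (rule finite_subsets_through)
  have "\<Inter> (insert (?H (S - {i})) (?H ` ?\<B>)) \<noteq> {}"
  proof (rule helly_finite)
    show "finite (insert (?H (S - {i})) (?H ` ?\<B>))"
      using fin\<B> by simp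
    show "convex C" if "C \<in> insert (?H (S - {i})) (?H ` ?\<B>)" for C
      using that convex_convex_hull by auto
    fix \<T> assume \<T>: "\<T> \<subseteq> insert (?H (S - {i})) (?H ` ?\<B>)"
      and card\<T>: "card \<T> \<le> DIM(real ^ 'n) + 1"
    have fin\<T>: "finite \<T>"
      using \<T> fin\<B> by (simp add: finite_subset)
    define \<U> where "\<U> = \<T> - {?H (S - {i})}"
    have "\<U> \<subseteq> ?H ` ?\<B>" using \<T> by (auto simp: \<U>_def)
    \<comment> \<open>Different sets \<open>B\<close> can have the same hull; one is kept for each
      hull, so that the bound on \<open>card \<T>\<close> also bounds the number of sets
      \<open>B\<close>.\<close>
    then obtain \<C> where \<C>: "\<C> \<subseteq> ?\<B>" "inj_on ?H \<C>" "\<U> = ?H ` \<C>"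
      unfolding subset_image_inj by blast
    show "\<Inter> \<T> \<noteq> {}"
    proof (cases "?H (S - {i}) \<in> \<T>")
      case False
      then have "\<T> = ?H ` \<C>" using \<C> by (auto simp: \<U>_def)
      moreover have "x i \<in> ?H B" if "B \<in> \<C>" for B
        using that \<C> by (intro hull_inc) (auto simp: subsets_through_def)
      ultimately show ?thesis by blast
    next
      case True
      have fin\<C>: "finite \<C>" using \<C>(1) fin\<B> by (rule finite_subset)
      have "card \<C> = card \<U>" using \<C> by (simp add: card_image)
      also have "\<dots> \<le> CARD('n)"
        using True card\<T> fin\<T> by (simp add: \<U>_def)
      finally have "card \<C> \<le> CARD('n)" .
      have "card (S - B) \<le> \<kappa>" if "B \<in> \<C>" for B
      proof -
        have "B \<subseteq> S" "card B = card S - \<kappa>" using that \<C> by (auto simp: subsets_through_def)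
        then show ?thesis using assms(1) by (simp add: card_Diff_subset finite_subset)
      qed
      then have "card (\<Union>B\<in>\<C>. S - B) \<le> card \<C> * \<kappa>"
        using fin\<C> card_UN_le[of \<C> "\<lambda>B. S - B"] sum_bounded_above[of \<C> "\<lambda>B. card (S - B)" \<kappa>]
        by fastforce
      also have "\<dots> \<le> CARD('n) * \<kappa>" using \<open>card \<C> \<le> CARD('n)\<close> by simp
      \<comment> \<open>Of the summand 2 in \<open>card\<close>, one unit pays for \<open>i\<close>
        and the other makes the inequality strict.\<close>
      also have "\<dots> < card (S - {i})" using card assms by simp
      finally have "\<not> S - {i} \<subseteq> (\<Union>B\<in>\<C>. S - B)"
        using assms(1) fin\<C> card_mono[of "\<Union>B\<in>\<C>. S - B" "S - {i}"] by fastforce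
      then obtain j where j: "j \<in> S - {i}" "\<And>B. B \<in> \<C> \<Longrightarrow> j \<in> B" by auto
      have "x j \<in> C" if "C \<in> \<T>" for C
      proof (cases "C = ?H (S - {i})")
        case True
        then show ?thesis using j by (auto intro: hull_inc)
      next
        case False
        then have "C \<in> ?H ` \<C>" using that \<C>(3) unfolding \<U>_def by blast
        then obtain B where "B \<in> \<C>" "C = ?H B" by blast
        then show ?thesis using j(2) by (simp add: hull_inc)
      qed
      then show ?thesis by blast
    qed
  qed
  then show ?thesis using False unfolding admissible_points_def by (simp add: Int_commute)
qed

section \<open>Position of the chosen points\<close>

text \<open>Because this hull leaves out \<open>i\<close>, the heavy weight found for
  \<open>S\<close> falls on another agent.\<close>

lemma admissible_points_subset_hull:
  assumes "p \<in> admissible_points i x \<kappa> S"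
  shows "p \<in> convex hull (x ` (S - {i}))"
  using assms by (auto simp: admissible_points_def split: if_splits)

lemma admissible_points_subset_normal_hull:
  assumes "p \<in> admissible_points i x \<kappa> S" "i \<in> S" "i \<in> N" "finite S"
    and "card (S - N) \<le> \<kappa>" "\<kappa> < card S"
  shows "p \<in> convex hull (x ` N)"
proof (cases "x i \<in> convex hull (x ` (S - {i}))")
  case True
  then show ?thesis using assms by (auto simp: admissible_points_def intro: hull_inc)
next
  case False
  have "card S = card (S \<inter> N) + card (S - N)"
    using assms(4) card_Int_Diff by blast
  moreover have "card (S \<inter> N - {i}) = card (S \<inter> N) - 1"
    using assms by simp
  \<comment> \<open>At most \<kappa> agents of \<open>S\<close> are not normal, so enough normal
    ones remain to complete \<open>i\<close> to one of the sets \<open>B\<close>; the 1 accounts for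
    \<open>i\<close>.\<close>
  ultimately have "card S - \<kappa> - 1 \<le> card (S \<inter> N - {i})" using assms by linarith
  then obtain T where T: "T \<subseteq> S \<inter> N - {i}" "card T = card S - \<kappa> - 1" "finite T"
    by (rule obtain_subset_with_card_n)
  moreover have "i \<notin> T" using T by auto
  ultimately have "insert i T \<in> subsets_through i S (card S - \<kappa>)"
    using assms by (auto simp: subsets_through_def)
  then have "p \<in> convex hull (x ` insert i T)"
    using assms(1) False by (auto simp: admissible_points_def)
  moreover have "convex hull (x ` insert i T) \<subseteq> convex hull (x ` N)"
    using T assms by (intro hull_mono image_mono) auto
  ultimately show ?thesis by blast
qed

text \<open>Keeps the guarantee about all outputs from being vacuous; the points for the different
  \<open>S\<close> are chosen independently.\<close>

lemma algorithm_output_exists: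
  fixes x :: "'a \<Rightarrow> real ^ 'n"
  assumes "finite Np" "CARD('n) * \<kappa> + 2 \<le> \<sigma>"
  shows "\<exists>v. algorithm_output i Np x \<kappa> \<sigma> v"
proof -
  have "\<forall>S \<in> subsets_through i Np \<sigma>. \<exists>p. p \<in> admissible_points i x \<kappa> S"
  proof
    fix S assume "S \<in> subsets_through i Np \<sigma>"
    then have "finite S" "i \<in> S" "card S = \<sigma>"
      using assms finite_subset by (auto simp: subsets_through_def)
    then show "\<exists>p. p \<in> admissible_points i x \<kappa> S"
      using admissible_points_nonempty[of S i \<kappa> x] assms by auto
  qed
  then obtain \<phi> where "\<forall>S \<in> subsets_through i Np \<sigma>. \<phi> S \<in> admissible_points i x \<kappa> S"
    by metis
  then show ?thesis unfolding algorithm_output_def by blast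
qed

section \<open>Weights of the output\<close>

text \<open>The output averages \<open>s + 1\<close> convex combinations of normal states, so a
  weight ?\<beta> in a single one of them survives as
  \<open>?\<beta> / (real s + 1)\<close>.\<close>

lemma algorithm_output_resilient:
  fixes x :: "'a \<Rightarrow> real ^ 'n"
  assumes "finite N" "finite M" "i \<in> N" "N \<inter> M = {}" "card M < \<sigma>" "2 \<le> \<sigma>" "\<sigma> \<le> card N"
    and out: "algorithm_output i (N \<union> M) x (card M) \<sigma> v"
  defines "s \<equiv> (card (N \<union> M) - 1) choose (\<sigma> - 1)"
  shows "resilient_convex_combination (card N - \<sigma> + 2)
    (1 / ((real s + 1) * (real CARD('n) + 1))) N x v"
proof -
  let ?\<S> = "subsets_through i (N \<union> M) \<sigma>"
  let ?\<beta> = "1 / (real CARD('n) + 1)"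
  have fin\<S>: "finite ?\<S>" using assms by (intro finite_subsets_through) auto
  have card\<S>: "card ?\<S> = s"
    using assms by (simp add: card_subsets_through)
  obtain \<phi> where \<phi>: "\<And>S. S \<in> ?\<S> \<Longrightarrow> \<phi> S \<in> admissible_points i x (card M) S"
    and v: "v = (1 / (real s + 1)) *\<^sub>R (x i + (\<Sum>S \<in> ?\<S>. \<phi> S))"
    using out by (auto simp: algorithm_output_def s_def)
  let ?weights = "\<lambda>S u. (\<forall>l. 0 \<le> u l) \<and> sum u N = 1 \<and> \<phi> S = (\<Sum>l\<in>N. u l *\<^sub>R x l) \<and>
      (S \<subseteq> N \<longrightarrow> (\<exists>j\<in>S - {i}. ?\<beta> \<le> u j))"
  have "\<exists>u. ?weights S u" if S: "S \<in> ?\<S>" for S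
  proof (cases "S \<subseteq> N")
    case True
    obtain u where "\<And>l. 0 \<le> u l" "sum u N = 1" "\<phi> S = (\<Sum>l\<in>N. u l *\<^sub>R x l)"
        "\<exists>j\<in>S - {i}. 1 / (real DIM(real ^ 'n) + 1) \<le> u j"
      using convex_hull_image_weights[OF admissible_points_subset_hull[OF \<phi>[OF S]] _ assms(1)]
        True by blast
    then show ?thesis by auto
  next
    case False
    have "S \<subseteq> N \<union> M" "i \<in> S" "card S = \<sigma>" using S by (auto simp: subsets_through_def)
    moreover have "finite S" using calculation assms finite_subset by blast
    moreover have "card (S - N) \<le> card M" using calculation assms by (intro card_mono) auto
    ultimately have "\<phi> S \<in> convex hull (x ` N)"
      using assms by (intro admissible_points_subset_normal_hull[OF \<phi>[OF S]]) auto
    then obtain u where "\<And>l. 0 \<le> u l" "sum u N = 1" "\<phi> S = (\<Sum>l\<in>N. u l *\<^sub>R x l)"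
      using convex_hull_image_weights[OF _ subset_refl assms(1)] by blast
    then show ?thesis using False by blast
  qed
  then have "\<forall>S\<in>?\<S>. \<exists>u. ?weights S u" by blast
  from bchoice[OF this] obtain u where "\<forall>S\<in>?\<S>. ?weights S (u S)" by (rule exE)
  then have u0: "\<And>S l. S \<in> ?\<S> \<Longrightarrow> 0 \<le> u S l"
    and u1: "\<And>S. S \<in> ?\<S> \<Longrightarrow> sum (u S) N = 1"
    and u\<phi>: "\<And>S. S \<in> ?\<S> \<Longrightarrow> \<phi> S = (\<Sum>l\<in>N. u S l *\<^sub>R x l)"
    and u\<beta>: "\<And>S. S \<in> ?\<S> \<Longrightarrow> S \<subseteq> N \<Longrightarrow> \<exists>j\<in>S - {i}. ?\<beta> \<le> u S j"
    by simp_all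
  \<comment> \<open>The \<open>of_bool\<close> term is the weight vector of the summand
    \<open>x i\<close>, which the algorithm adds to the points \<phi>.\<close>
  define w where "w l = (of_bool (l = i) + (\<Sum>S\<in>?\<S>. u S l)) / (real s + 1)" for l
  have w0: "0 \<le> w l" for l
    using u0 by (auto simp: w_def intro!: divide_nonneg_nonneg add_nonneg_nonneg sum_nonneg)
  have "(\<Sum>l\<in>N. \<Sum>S\<in>?\<S>. u S l) = (\<Sum>S\<in>?\<S>. sum (u S) N)" by (rule sum.swap)
  also have "\<dots> = real s" using u1 card\<S> by simp
  finally have sum_w: "sum w N = 1"
    using assms(1,3) by (simp add: w_def sum.distrib flip: sum_divide_distrib)
  have "(\<Sum>S\<in>?\<S>. \<phi> S) = (\<Sum>S\<in>?\<S>. \<Sum>l\<in>N. u S l *\<^sub>R x l)" using u\<phi> by simp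
  also have "\<dots> = (\<Sum>l\<in>N. (\<Sum>S\<in>?\<S>. u S l) *\<^sub>R x l)"
    by (subst sum.swap) (simp add: scaleR_left.sum)
  moreover have "x i = (\<Sum>l\<in>N. of_bool (l = i) *\<^sub>R x l)"
    using assms(1,3) by (simp add: of_bool_def if_distrib[of "\<lambda>c. c *\<^sub>R _"] cong: if_cong)
  ultimately have v_eq: "v = (\<Sum>l\<in>N. w l *\<^sub>R x l)"
    unfolding v w_def
    by (simp add: sum.distrib[symmetric] scaleR_add_left[symmetric] scaleR_sum_right)
  let ?L = "{l \<in> N. ?\<beta> / (real s + 1) \<le> w l}"
  have mono: "?\<beta> / (real s + 1) \<le> w l"
    if "?\<beta> \<le> of_bool (l = i) + (\<Sum>S\<in>?\<S>. u S l)" for l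
    unfolding w_def using that by (intro divide_right_mono) auto
  have iL: "i \<in> ?L"
  proof -
    have "?\<beta> \<le> 1" by simp
    also have "1 \<le> of_bool (i = i) + (\<Sum>S\<in>?\<S>. u S i)" using u0 by (simp add: sum_nonneg)
    finally show ?thesis using assms(3) mono by blast
  qed
  \<comment> \<open>Otherwise \<open>i\<close> and \<sigma> - 1 light normal agents form a selected
    set, whose own point gives one of these agents weight at least ?\<beta>, so that agent is not
    light.\<close>
  have "card (N - ?L) < \<sigma> - 1"
  proof (rule ccontr)
    assume "\<not> ?thesis"
    then obtain T where T: "T \<subseteq> N - ?L" "card T = \<sigma> - 1" "finite T"
      by (meson not_less obtain_subset_with_card_n)
    have iT: "i \<notin> T" using T iL by auto
    have S: "insert i T \<in> ?\<S>" "insert i T \<subseteq> N"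
      using T iT assms by (auto simp: subsets_through_def)
    then obtain j where j: "j \<in> T" "?\<beta> \<le> u (insert i T) j" using u\<beta> by blast
    note j(2)
    also have "u (insert i T) j \<le> (\<Sum>S\<in>?\<S>. u S j)"
      using fin\<S> S u0 by (intro member_le_sum) auto
    finally have "?\<beta> / (real s + 1) \<le> w j" by (intro mono) (simp add: add_increasing)
    then show False using j T by auto
  qed
  moreover have "card (N - ?L) = card N - card ?L"
    using assms(1) by (intro card_Diff_subset) auto
  \<comment> \<open>At most \<sigma> - 2 agents are light; \<open>\<sigma> \<le> card N\<close>
    keeps the subtraction of naturals exact.\<close>
  ultimately have "card N - \<sigma> + 2 \<le> card ?L" using \<open>\<sigma> \<le> card N\<close> by linarith
  moreover have "w l \<le> 1" if "l \<in> N" for l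
    using member_le_sum[of l N w] that assms(1) w0 sum_w by simp
  ultimately show ?thesis
    unfolding resilient_convex_combination_def
    using w0 sum_w v_eq by (intro exI[of _ w]) (auto simp: mult.commute)
qed

theorem theorem1:
  fixes i :: 'a and N M :: "'a set" and x :: "'a \<Rightarrow> real ^ 'n" and \<kappa> d \<sigma> :: nat
  assumes "finite N" and "finite M" and "N \<inter> M = {}" and "i \<in> N"
    and "\<kappa> = card M" and "d = card (N \<union> M)"
    and "d \<ge> (CARD('n) + 1) * \<kappa> + 2"
    and "CARD('n) * \<kappa> + 2 \<le> \<sigma>" and "\<sigma> \<le> d - \<kappa>"
  shows "(\<exists>v. algorithm_output i (N \<union> M) x \<kappa> \<sigma> v) \<and>
    (\<forall>v. algorithm_output i (N \<union> M) x \<kappa> \<sigma> v \<longrightarrow>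
       resilient_convex_combination (d - \<kappa> - \<sigma> + 2)
         (1 / ((real ((d - 1) choose (\<sigma> - 1)) + 1) * (real CARD('n) + 1))) N x v)"
proof -
  have card: "card N = d - \<kappa>" using assms by (simp add: card_Un_disjoint)
  \<comment> \<open>The dimension is at least 1, so the lower bound on \<sigma> also gives
    \<open>\<kappa> < \<sigma>\<close>, as needed for the sets \<open>B\<close> to be
    nonempty.\<close>
  have "1 * \<kappa> \<le> CARD('n) * \<kappa>" by (intro mult_right_mono) (simp_all add: Suc_leI)
  then have "card M < \<sigma>" using assms by linarith
  then show ?thesis
    using algorithm_output_exists[of "N \<union> M" \<kappa> \<sigma> i x]
      algorithm_output_resilient[of N M i \<sigma> x] assms card by auto
qed

end
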